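(* For any $\Gamma\cup\{\varphi\}\subseteq Fm_{\mathcal L}$: $\Gamma\vdash_{\mathbf{GV}}\varphi\Leftrightarrow\Gamma\models_g\varphi$, and $\Gamma\vdash_{\mathbf{LV}}\varphi\Leftrightarrow\Gamma\models_l\varphi$.
   Context: $\mathcal L$ is the language $\{\land,\lor,\to,0,1\}$ expanded with a binary counterfactual connective $\mathbin{\Box\!\!\rightarrow}$. With axioms (L1) $\varphi\mathbin{\Box\!\!\rightarrow}\varphi$, (L2) $((\varphi\mathbin{\Box\!\!\rightarrow}\psi)\wedge(\psi\mathbin{\Box\!\!\rightarrow}\varphi))\to((\varphi\mathbin{\Box\!\!\rightarrow}\gamma)\leftrightarrow(\psi\mathbin{\Box\!\!\rightarrow}\gamma))$, (L3) $((\varphi\vee\psi)\mathbin{\Box\!\!\rightarrow}\varphi)\vee((\varphi\vee\psi)\mathbin{\Box\!\!\rightarrow}\psi)\vee(((\varphi\vee\psi)\mathbin{\Box\!\!\rightarrow}\gamma)\leftrightarrow((\varphi\mathbin{\Box\!\!\rightarrow}\gamma)\wedge(\psi\mathbin{\Box\!\!\rightarrow}\gamma)))$, (L4) $(\varphi\mathbin{\Box\!\!\rightarrow}(\psi\land\gamma))\leftrightarrow((\varphi\mathbin{\Box\!\!\rightarrow}\psi)\land(\varphi\mathbin{\Box\!\!\rightarrow}\gamma))$ plus classical axioms and modus ponens, $\mathbf{GV}$ is the smallest finitary consequence relation also closed under (C) $\varphi\to\psi\vdash(\gamma\mathbin{\Box\!\!\rightarrow}\varphi)\to(\gamma\mathbin{\Box\!\!\rightarrow}\psi)$,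 and $\mathbf{LV}$ the one closed only under: if $\vdash\varphi\to\psi$ then $\vdash(\gamma\mathbin{\Box\!\!\rightarrow}\varphi)\to(\gamma\mathbin{\Box\!\!\rightarrow}\psi)$. A sphere model is $(W,\mathcal S,v)$ with each $\mathcal S(w)$ a family of nonempty nested subsets of $W$ and $v$ extended classically and by $v(\varphi\mathbin{\Box\!\!\rightarrow}\psi)=\{w:\bigcup\mathcal S(w)\cap v(\varphi)=\emptyset$ or $\exists S\in\mathcal S(w)$, $\emptyset\neq S\cap v(\varphi)\subseteq v(\psi)\}$. $\models_g$: over all sphere models, truth of $\Gamma$ at all worlds implies truth of $\varphi$ at all worlds; $\models_l$: over all sphere models and worlds $w$, truth of $\Gamma$ at $w$ implies truth of $\varphi$ at $w$. *)

theory Defs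
  imports Main
begin

section \<open>Formulas\<close>

datatype fm =
    Var nat
  | Zero  (\<open>\<^bold>0\<close>)
  | One  (\<open>\<^bold>1\<close>)
  | Conj fm fm  (infixr \<open>\<^bold>\<and>\<close> 65)
  | Disj fm fm  (infixr \<open>\<^bold>\<or>\<close> 60)
  | Impl fm fm  (infixr \<open>\<^bold>\<rightarrow>\<close> 55)
  | Cf fm fm  (infix \<open>\<box>\<rightarrow>\<close> 70)

abbreviation Neg :: "fm \<Rightarrow> fm"  (\<open>\<^bold>\<not> _\<close> [75] 75)
  where "\<^bold>\<not> \<phi> \<equiv> \<phi> \<^bold>\<rightarrow> \<^bold>0"

abbreviation Iff :: "fm \<Rightarrow> fm \<Rightarrow> fm"  (infix \<open>\<^bold>\<leftrightarrow>\<close> 53)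
  where "\<phi> \<^bold>\<leftrightarrow> \<psi> \<equiv> (\<phi> \<^bold>\<rightarrow> \<psi>) \<^bold>\<and> (\<psi> \<^bold>\<rightarrow> \<phi>)"


section \<open>The two calculi\<close>

inductive classical_axiom :: "fm \<Rightarrow> bool" where
  "classical_axiom (\<phi> \<^bold>\<rightarrow> (\<psi> \<^bold>\<rightarrow> \<phi>))"
| "classical_axiom ((\<phi> \<^bold>\<rightarrow> (\<psi> \<^bold>\<rightarrow> \<gamma>)) \<^bold>\<rightarrow> ((\<phi> \<^bold>\<rightarrow> \<psi>) \<^bold>\<rightarrow> (\<phi> \<^bold>\<rightarrow> \<gamma>)))"
| "classical_axiom ((\<phi> \<^bold>\<and> \<psi>) \<^bold>\<rightarrow> \<phi>)"
| "classical_axiom ((\<phi> \<^bold>\<and> \<psi>) \<^bold>\<rightarrow> \<psi>)"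
| "classical_axiom (\<phi> \<^bold>\<rightarrow> (\<psi> \<^bold>\<rightarrow> (\<phi> \<^bold>\<and> \<psi>)))"
| "classical_axiom (\<phi> \<^bold>\<rightarrow> (\<phi> \<^bold>\<or> \<psi>))"
| "classical_axiom (\<psi> \<^bold>\<rightarrow> (\<phi> \<^bold>\<or> \<psi>))"
| "classical_axiom ((\<phi> \<^bold>\<rightarrow> \<gamma>) \<^bold>\<rightarrow> ((\<psi> \<^bold>\<rightarrow> \<gamma>) \<^bold>\<rightarrow> ((\<phi> \<^bold>\<or> \<psi>) \<^bold>\<rightarrow> \<gamma>)))"
| "classical_axiom (\<^bold>0 \<^bold>\<rightarrow> \<phi>)"
| "classical_axiom \<^bold>1"
| "classical_axiom (\<phi> \<^bold>\<or> \<^bold>\<not> \<phi>)"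

inductive V_axiom :: "fm \<Rightarrow> bool" where
  Cl: "classical_axiom \<phi> \<Longrightarrow> V_axiom \<phi>"
| L1: "V_axiom (\<phi> \<box>\<rightarrow> \<phi>)"
| L2: "V_axiom (((\<phi> \<box>\<rightarrow> \<psi>) \<^bold>\<and> (\<psi> \<box>\<rightarrow> \<phi>)) \<^bold>\<rightarrow> ((\<phi> \<box>\<rightarrow> \<gamma>) \<^bold>\<leftrightarrow> (\<psi> \<box>\<rightarrow> \<gamma>)))"
| L3: "V_axiom (((\<phi> \<^bold>\<or> \<psi>) \<box>\<rightarrow> \<phi>) \<^bold>\<or> ((\<phi> \<^bold>\<or> \<psi>) \<box>\<rightarrow> \<psi>) \<^bold>\<or>
         (((\<phi> \<^bold>\<or> \<psi>) \<box>\<rightarrow> \<gamma>) \<^bold>\<leftrightarrow> ((\<phi> \<box>\<rightarrow> \<gamma>) \<^bold>\<and> (\<psi> \<box>\<rightarrow> \<gamma>))))"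
| L4: "V_axiom ((\<phi> \<box>\<rightarrow> (\<psi> \<^bold>\<and> \<gamma>)) \<^bold>\<leftrightarrow> ((\<phi> \<box>\<rightarrow> \<psi>) \<^bold>\<and> (\<phi> \<box>\<rightarrow> \<gamma>)))"

definition consequence_relation :: "(fm set \<Rightarrow> fm \<Rightarrow> bool) \<Rightarrow> bool" where
  "consequence_relation R \<longleftrightarrow>
     (\<forall>\<Gamma> \<phi>. \<phi> \<in> \<Gamma> \<longrightarrow> R \<Gamma> \<phi>) \<and>
     (\<forall>\<Gamma> \<Delta> \<phi>. R \<Gamma> \<phi> \<longrightarrow> \<Gamma> \<subseteq> \<Delta> \<longrightarrow> R \<Delta> \<phi>) \<and>
     (\<forall>\<Gamma> \<Delta> \<phi>. (\<forall>\<psi>\<in>\<Delta>. R \<Gamma> \<psi>) \<longrightarrow> R \<Delta> \<phi> \<longrightarrow> R \<Gamma> \<phi>)"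

definition finitary :: "(fm set \<Rightarrow> fm \<Rightarrow> bool) \<Rightarrow> bool" where
  "finitary R \<longleftrightarrow> (\<forall>\<Gamma> \<phi>. R \<Gamma> \<phi> \<longrightarrow> (\<exists>\<Delta>. finite \<Delta> \<and> \<Delta> \<subseteq> \<Gamma> \<and> R \<Delta> \<phi>))"

definition base_closed :: "(fm set \<Rightarrow> fm \<Rightarrow> bool) \<Rightarrow> bool" where
  "base_closed R \<longleftrightarrow> consequence_relation R \<and> finitary R \<and>
     (\<forall>\<phi>. V_axiom \<phi> \<longrightarrow> R {} \<phi>) \<and> (\<forall>\<phi> \<psi>. R {\<phi>, \<phi> \<^bold>\<rightarrow> \<psi>} \<psi>)"

definition GV_closed :: "(fm set \<Rightarrow> fm \<Rightarrow> bool) \<Rightarrow> bool" where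
  "GV_closed R \<longleftrightarrow> base_closed R \<and>
     (\<forall>\<phi> \<psi> \<gamma>. R {\<phi> \<^bold>\<rightarrow> \<psi>} ((\<gamma> \<box>\<rightarrow> \<phi>) \<^bold>\<rightarrow> (\<gamma> \<box>\<rightarrow> \<psi>)))"

definition LV_closed :: "(fm set \<Rightarrow> fm \<Rightarrow> bool) \<Rightarrow> bool" where
  "LV_closed R \<longleftrightarrow> base_closed R \<and>
     (\<forall>\<phi> \<psi> \<gamma>. R {} (\<phi> \<^bold>\<rightarrow> \<psi>) \<longrightarrow> R {} ((\<gamma> \<box>\<rightarrow> \<phi>) \<^bold>\<rightarrow> (\<gamma> \<box>\<rightarrow> \<psi>)))"

text \<open>
  Finitary relations are not closed under intersection in general, so it is not immediate that the
  intersections below are themselves \<open>GV_closed\<close> and \<open>LV_closed\<close>; see \<open>GV_least\<close> and \<open>LV_least\<close>.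
\<close>

definition GV :: "fm set \<Rightarrow> fm \<Rightarrow> bool"  (infix \<open>\<turnstile>GV\<close> 50) where
  "\<Gamma> \<turnstile>GV \<phi> \<longleftrightarrow> (\<forall>R. GV_closed R \<longrightarrow> R \<Gamma> \<phi>)"

definition LV :: "fm set \<Rightarrow> fm \<Rightarrow> bool"  (infix \<open>\<turnstile>LV\<close> 50) where
  "\<Gamma> \<turnstile>LV \<phi> \<longleftrightarrow> (\<forall>R. LV_closed R \<longrightarrow> R \<Gamma> \<phi>)"


subsection \<open>Hilbert-style derivations\<close>

inductive GV_deriv :: "fm set \<Rightarrow> fm \<Rightarrow> bool" for \<Gamma> where
  hyp: "\<phi> \<in> \<Gamma> \<Longrightarrow> GV_deriv \<Gamma> \<phi>"
| ax: "V_axiom \<phi> \<Longrightarrow> GV_deriv \<Gamma> \<phi>"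
| MP: "GV_deriv \<Gamma> \<phi> \<Longrightarrow> GV_deriv \<Gamma> (\<phi> \<^bold>\<rightarrow> \<psi>) \<Longrightarrow> GV_deriv \<Gamma> \<psi>"
| C: "GV_deriv \<Gamma> (\<phi> \<^bold>\<rightarrow> \<psi>) \<Longrightarrow> GV_deriv \<Gamma> ((\<gamma> \<box>\<rightarrow> \<phi>) \<^bold>\<rightarrow> (\<gamma> \<box>\<rightarrow> \<psi>))"

inductive LV_deriv :: "fm set \<Rightarrow> fm \<Rightarrow> bool" for \<Gamma> where
  hyp: "\<phi> \<in> \<Gamma> \<Longrightarrow> LV_deriv \<Gamma> \<phi>"
| thmI: "GV_deriv {} \<phi> \<Longrightarrow> LV_deriv \<Gamma> \<phi>"
| MP: "LV_deriv \<Gamma> \<phi> \<Longrightarrow> LV_deriv \<Gamma> (\<phi> \<^bold>\<rightarrow> \<psi>) \<Longrightarrow> LV_deriv \<Gamma> \<psi>"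

lemma GV_deriv_cut:
  assumes "GV_deriv \<Delta> \<phi>" and "\<forall>\<psi>\<in>\<Delta>. GV_deriv \<Gamma> \<psi>"
  shows "GV_deriv \<Gamma> \<phi>"
  using assms(1)
proof (induction rule: GV_deriv.induct)
  case (hyp \<phi>)
  then show ?case using assms(2) by blast
next
  case (MP \<phi> \<psi>)
  show ?case using MP.IH by (rule GV_deriv.MP)
next
  case (C \<phi> \<psi> \<gamma>)
  show ?case using C.IH by (rule GV_deriv.C)
qed (rule GV_deriv.ax)

lemma GV_deriv_mono: "GV_deriv \<Gamma> \<phi> \<Longrightarrow> \<Gamma> \<subseteq> \<Delta> \<Longrightarrow> GV_deriv \<Delta> \<phi>"
  by (erule GV_deriv_cut) (simp add: GV_deriv.hyp subset_iff)

lemma LV_deriv_cut: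
  assumes "LV_deriv \<Delta> \<phi>" and "\<forall>\<psi>\<in>\<Delta>. LV_deriv \<Gamma> \<psi>"
  shows "LV_deriv \<Gamma> \<phi>"
  using assms(1)
proof (induction rule: LV_deriv.induct)
  case (hyp \<phi>)
  then show ?case using assms(2) by blast
next
  case (MP \<phi> \<psi>)
  show ?case using MP.IH by (rule LV_deriv.MP)
qed (rule LV_deriv.thmI)

lemma LV_deriv_mono: "LV_deriv \<Gamma> \<phi> \<Longrightarrow> \<Gamma> \<subseteq> \<Delta> \<Longrightarrow> LV_deriv \<Delta> \<phi>"
  by (erule LV_deriv_cut) (simp add: LV_deriv.hyp subset_iff)

lemma GV_deriv_finitary: "GV_deriv \<Gamma> \<phi> \<Longrightarrow> \<exists>\<Delta>. finite \<Delta> \<and> \<Delta> \<subseteq> \<Gamma> \<and> GV_deriv \<Delta> \<phi>"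
proof (induction rule: GV_deriv.induct)
  case (hyp \<phi>)
  then show ?case by (intro exI[of _ "{\<phi>}"]) (auto intro: GV_deriv.hyp)
next
  case (ax \<phi>)
  then show ?case by (intro exI[of _ "{}"]) (auto intro: GV_deriv.ax)
next
  case (MP \<phi> \<psi>)
  then obtain A B where "finite A" "A \<subseteq> \<Gamma>" "GV_deriv A \<phi>"
    and "finite B" "B \<subseteq> \<Gamma>" "GV_deriv B (\<phi> \<^bold>\<rightarrow> \<psi>)" by blast
  moreover from this have "GV_deriv (A \<union> B) \<psi>"
    by (metis GV_deriv.MP GV_deriv_mono Un_upper1 Un_upper2)
  ultimately show ?case by (intro exI[of _ "A \<union> B"]) simp
next
  case (C \<phi> \<psi> \<gamma>)
  then show ?case by (blast intro: GV_deriv.C)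
qed

lemma LV_deriv_finitary: "LV_deriv \<Gamma> \<phi> \<Longrightarrow> \<exists>\<Delta>. finite \<Delta> \<and> \<Delta> \<subseteq> \<Gamma> \<and> LV_deriv \<Delta> \<phi>"
proof (induction rule: LV_deriv.induct)
  case (hyp \<phi>)
  then show ?case by (intro exI[of _ "{\<phi>}"]) (auto intro: LV_deriv.hyp)
next
  case (thmI \<phi>)
  then show ?case by (intro exI[of _ "{}"]) (auto intro: LV_deriv.thmI)
next
  case (MP \<phi> \<psi>)
  then obtain A B where "finite A" "A \<subseteq> \<Gamma>" "LV_deriv A \<phi>"
    and "finite B" "B \<subseteq> \<Gamma>" "LV_deriv B (\<phi> \<^bold>\<rightarrow> \<psi>)" by blast
  moreover from this have "LV_deriv (A \<union> B) \<psi>"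
    by (metis LV_deriv.MP LV_deriv_mono Un_upper1 Un_upper2)
  ultimately show ?case by (intro exI[of _ "A \<union> B"]) simp
qed

lemma LV_deriv_empty: "LV_deriv {} \<phi> \<longleftrightarrow> GV_deriv {} \<phi>"
proof
  show "LV_deriv {} \<phi> \<Longrightarrow> GV_deriv {} \<phi>"
  proof (induction rule: LV_deriv.induct)
    case (MP \<phi> \<psi>)
    show ?case using MP.IH by (rule GV_deriv.MP)
  qed simp_all
qed (rule LV_deriv.thmI)

lemma base_closed_hyp: "base_closed R \<Longrightarrow> \<phi> \<in> \<Gamma> \<Longrightarrow> R \<Gamma> \<phi>"
  by (simp add: base_closed_def consequence_relation_def)

lemma base_closed_cut:
  assumes "base_closed R" and "\<forall>\<psi>\<in>\<Delta>. R \<Gamma> \<psi>" and "R \<Delta> \<phi>"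
  shows "R \<Gamma> \<phi>"
proof -
  have "\<forall>\<Gamma> \<Delta> \<phi>. (\<forall>\<psi>\<in>\<Delta>. R \<Gamma> \<psi>) \<longrightarrow> R \<Delta> \<phi> \<longrightarrow> R \<Gamma> \<phi>"
    using assms(1) unfolding base_closed_def consequence_relation_def by (elim conjE)
  from this[rule_format, OF assms(2)[rule_format] assms(3)] show ?thesis .
qed

lemma base_closed_weaken: "base_closed R \<Longrightarrow> R {} \<phi> \<Longrightarrow> R \<Gamma> \<phi>"
  by (rule base_closed_cut[of R "{}"]) simp_all

lemma base_closed_mp:
  assumes "base_closed R" and "R \<Gamma> \<phi>" and "R \<Gamma> (\<phi> \<^bold>\<rightarrow> \<psi>)"
  shows "R \<Gamma> \<psi>"
proof (rule base_closed_cut[of R "{\<phi>, \<phi> \<^bold>\<rightarrow> \<psi>}"])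
  show "R {\<phi>, \<phi> \<^bold>\<rightarrow> \<psi>} \<psi>" using assms(1) by (simp add: base_closed_def)
qed (use assms in simp_all)

lemma base_closed_ax: "base_closed R \<Longrightarrow> V_axiom \<phi> \<Longrightarrow> R \<Gamma> \<phi>"
  by (rule base_closed_weaken) (simp_all add: base_closed_def)

lemma GV_deriv_least:
  assumes R: "GV_closed R" and "GV_deriv \<Gamma> \<phi>"
  shows "R \<Gamma> \<phi>"
  using assms(2)
proof (induction rule: GV_deriv.induct)
  case (C \<phi> \<psi> \<gamma>)
  show ?case
  proof (rule base_closed_cut[of R "{\<phi> \<^bold>\<rightarrow> \<psi>}"])
    show "R {\<phi> \<^bold>\<rightarrow> \<psi>} ((\<gamma> \<box>\<rightarrow> \<phi>) \<^bold>\<rightarrow> (\<gamma> \<box>\<rightarrow> \<psi>))"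
      using R by (simp add: GV_closed_def)
  qed (use R C.IH in \<open>simp_all add: GV_closed_def\<close>)
next
  case (MP \<phi> \<psi>)
  have "base_closed R" using R by (simp add: GV_closed_def)
  then show ?case using MP.IH by (rule base_closed_mp)
qed (use R in \<open>simp_all add: GV_closed_def base_closed_hyp base_closed_ax\<close>)

lemma LV_deriv_least:
  assumes R: "LV_closed R" and "LV_deriv \<Gamma> \<phi>"
  shows "R \<Gamma> \<phi>"
proof -
  have b: "base_closed R" using R by (simp add: LV_closed_def)
  have thms: "R {} \<chi>" if "GV_deriv {} \<chi>" for \<chi>
    using that
  proof (induction rule: GV_deriv.induct)
    case (C \<phi> \<psi> \<gamma>)
    then show ?case using R by (simp add: LV_closed_def)
  next
    case (MP \<phi> \<psi>)
    show ?case using b MP.IH by (rule base_closed_mp)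
  qed (use b in \<open>simp_all add: base_closed_ax\<close>)
  show ?thesis
    using assms(2)
  proof (induction rule: LV_deriv.induct)
    case (MP \<phi> \<psi>)
    show ?case using b MP.IH by (rule base_closed_mp)
  qed (simp_all add: base_closed_hyp[OF b] base_closed_weaken[OF b thms])
qed

lemma GV_closed_GV_deriv: "GV_closed GV_deriv"
  unfolding GV_closed_def base_closed_def consequence_relation_def finitary_def
proof (intro conjI allI impI)
  show "GV_deriv {\<phi>, \<phi> \<^bold>\<rightarrow> \<psi>} \<psi>" for \<phi> \<psi>
    by (rule GV_deriv.MP[of _ \<phi>]) (simp_all add: GV_deriv.hyp)
  show "GV_deriv {\<phi> \<^bold>\<rightarrow> \<psi>} ((\<gamma> \<box>\<rightarrow> \<phi>) \<^bold>\<rightarrow> (\<gamma> \<box>\<rightarrow> \<psi>))" for \<phi> \<psi> \<gamma>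
    by (rule GV_deriv.C) (simp add: GV_deriv.hyp)
  show "GV_deriv \<Gamma> \<phi>" if "\<forall>\<psi>\<in>\<Delta>. GV_deriv \<Gamma> \<psi>" "GV_deriv \<Delta> \<phi>" for \<Gamma> \<Delta> \<phi>
    using that(2,1) by (rule GV_deriv_cut)
  show "GV_deriv \<Delta> \<phi>" if "GV_deriv \<Gamma> \<phi>" "\<Gamma> \<subseteq> \<Delta>" for \<Gamma> \<Delta> \<phi>
    using that by (rule GV_deriv_mono)
qed (simp_all add: GV_deriv.ax GV_deriv.hyp GV_deriv_finitary)

lemma LV_closed_LV_deriv: "LV_closed LV_deriv"
  unfolding LV_closed_def base_closed_def consequence_relation_def finitary_def
proof (intro conjI allI impI)
  show "LV_deriv {\<phi>, \<phi> \<^bold>\<rightarrow> \<psi>} \<psi>" for \<phi> \<psi>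
    by (rule LV_deriv.MP[of _ \<phi>]) (simp_all add: LV_deriv.hyp)
  show "LV_deriv {} \<phi>" if "V_axiom \<phi>" for \<phi>
    using that by (intro LV_deriv.thmI GV_deriv.ax)
  show "LV_deriv {} ((\<gamma> \<box>\<rightarrow> \<phi>) \<^bold>\<rightarrow> (\<gamma> \<box>\<rightarrow> \<psi>))" if "LV_deriv {} (\<phi> \<^bold>\<rightarrow> \<psi>)" for \<phi> \<psi> \<gamma>
    using that unfolding LV_deriv_empty by (rule GV_deriv.C)
  show "LV_deriv \<Gamma> \<phi>" if "\<forall>\<psi>\<in>\<Delta>. LV_deriv \<Gamma> \<psi>" "LV_deriv \<Delta> \<phi>" for \<Gamma> \<Delta> \<phi>
    using that(2,1) by (rule LV_deriv_cut)
  show "LV_deriv \<Delta> \<phi>" if "LV_deriv \<Gamma> \<phi>" "\<Gamma> \<subseteq> \<Delta>" for \<Gamma> \<Delta> \<phi>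
    using that by (rule LV_deriv_mono)
qed (simp_all add: LV_deriv.hyp LV_deriv_finitary)

lemma GV_iff_deriv: "\<Gamma> \<turnstile>GV \<phi> \<longleftrightarrow> GV_deriv \<Gamma> \<phi>"
  unfolding GV_def
proof (intro iffI allI impI)
  assume "\<forall>R. GV_closed R \<longrightarrow> R \<Gamma> \<phi>"
  from this[THEN spec, of GV_deriv] show "GV_deriv \<Gamma> \<phi>"
    using GV_closed_GV_deriv by (rule mp)
qed (rule GV_deriv_least)

lemma LV_iff_deriv: "\<Gamma> \<turnstile>LV \<phi> \<longleftrightarrow> LV_deriv \<Gamma> \<phi>"
  unfolding LV_def
proof (intro iffI allI impI)
  assume "\<forall>R. LV_closed R \<longrightarrow> R \<Gamma> \<phi>"
  from this[THEN spec, of LV_deriv] show "LV_deriv \<Gamma> \<phi>"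
    using LV_closed_LV_deriv by (rule mp)
qed (rule LV_deriv_least)

lemma GV_least:
  shows "GV_closed (\<turnstile>GV)" and "GV_closed R \<Longrightarrow> (\<turnstile>GV) \<le> R"
proof -
  have eq: "(\<turnstile>GV) = GV_deriv" by (intro ext) (rule GV_iff_deriv)
  show "GV_closed (\<turnstile>GV)" using GV_closed_GV_deriv by (simp add: eq)
  show "(\<turnstile>GV) \<le> R" if "GV_closed R"
    using GV_deriv_least[OF that] by (simp add: eq le_fun_def)
qed

lemma LV_least:
  shows "LV_closed (\<turnstile>LV)" and "LV_closed R \<Longrightarrow> (\<turnstile>LV) \<le> R"
proof -
  have eq: "(\<turnstile>LV) = LV_deriv" by (intro ext) (rule LV_iff_deriv)
  show "LV_closed (\<turnstile>LV)" using LV_closed_LV_deriv by (simp add: eq)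
  show "(\<turnstile>LV) \<le> R" if "LV_closed R"
    using LV_deriv_least[OF that] by (simp add: eq le_fun_def)
qed


section \<open>Sphere semantics\<close>

definition sphere_model ::
    "'w set \<Rightarrow> ('w \<Rightarrow> 'w set set) \<Rightarrow> (nat \<Rightarrow> 'w set) \<Rightarrow> bool" where
  "sphere_model W \<S> v \<longleftrightarrow>
     (\<forall>w\<in>W. (\<forall>S\<in>\<S> w. S \<noteq> {} \<and> S \<subseteq> W) \<and> (\<forall>S\<in>\<S> w. \<forall>T\<in>\<S> w. S \<subseteq> T \<or> T \<subseteq> S)) \<and>
     (\<forall>p. v p \<subseteq> W)"

fun truth_set ::
    "'w set \<Rightarrow> ('w \<Rightarrow> 'w set set) \<Rightarrow> (nat \<Rightarrow> 'w set) \<Rightarrow> fm \<Rightarrow> 'w set" where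
  "truth_set W \<S> v (Var p) = v p"
| "truth_set W \<S> v \<^bold>0 = {}"
| "truth_set W \<S> v \<^bold>1 = W"
| "truth_set W \<S> v (\<phi> \<^bold>\<and> \<psi>) = truth_set W \<S> v \<phi> \<inter> truth_set W \<S> v \<psi>"
| "truth_set W \<S> v (\<phi> \<^bold>\<or> \<psi>) = truth_set W \<S> v \<phi> \<union> truth_set W \<S> v \<psi>"
| "truth_set W \<S> v (\<phi> \<^bold>\<rightarrow> \<psi>) = (W - truth_set W \<S> v \<phi>) \<union> truth_set W \<S> v \<psi>"
| "truth_set W \<S> v (\<phi> \<box>\<rightarrow> \<psi>) =
     {w \<in> W. \<Union>(\<S> w) \<inter> truth_set W \<S> v \<phi> = {} \<or>
             (\<exists>S\<in>\<S> w. S \<inter> truth_set W \<S> v \<phi> \<noteq> {} \<and>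
                       S \<inter> truth_set W \<S> v \<phi> \<subseteq> truth_set W \<S> v \<psi>)}"

text \<open>
  The argument of type \<open>'w itself\<close> is the universe from which the sets of worlds are drawn:
  HOL cannot quantify over all types inside a formula.  A model is carried by a subset of \<open>'w\<close>, so
  every sphere model, finite or infinite, has an isomorphic copy over a suitable infinite \<open>'w\<close>, and
  every infinite \<open>'w\<close> has copies of all countable ones.
\<close>

definition models_g :: "'w itself \<Rightarrow> fm set \<Rightarrow> fm \<Rightarrow> bool" where
  "models_g (_ :: 'w itself) \<Gamma> \<phi> \<longleftrightarrow>
     (\<forall>(W :: 'w set) \<S> v. sphere_model W \<S> v \<longrightarrow>
        (\<forall>\<gamma>\<in>\<Gamma>. \<forall>w\<in>W. w \<in> truth_set W \<S> v \<gamma>) \<longrightarrow> (\<forall>w\<in>W. w \<in> truth_set W \<S> v \<phi>))"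

definition models_l :: "'w itself \<Rightarrow> fm set \<Rightarrow> fm \<Rightarrow> bool" where
  "models_l (_ :: 'w itself) \<Gamma> \<phi> \<longleftrightarrow>
     (\<forall>(W :: 'w set) \<S> v. sphere_model W \<S> v \<longrightarrow>
        (\<forall>w\<in>W. (\<forall>\<gamma>\<in>\<Gamma>. w \<in> truth_set W \<S> v \<gamma>) \<longrightarrow> w \<in> truth_set W \<S> v \<phi>))"

end

(* Completeness rests on one canonical construction. In a maximal consistent set w the conditional
   is a rational consequence relation in the sense of Lehmann and Magidor, so it induces a ranking of
   formulas by possibility. For each possible formula \<chi> the worlds containing no formula less
   possible than \<chi> form a sphere; transitivity of the ranking makes these spheres nested, and the
   conditional is true at w exactly when it belongs to w. For GV the worlds are the maximal
   consistent sets containing all consequences of the premises, for LV those containing all theorems.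
   The canonical model is uncountable, so a countable submodel is cut out of it before it is
   copied into the given infinite universe. *)

theory Submission
  imports Defs "HOL-Library.Countable_Set"
begin

section \<open>Soundness\<close>

text \<open>The clause for the counterfactual, stated for plain sets, so that soundness of the
  axioms becomes set algebra over a nested family.\<close>

definition sphere_cond :: "'w set set \<Rightarrow> 'w set \<Rightarrow> 'w set \<Rightarrow> bool" where
  "sphere_cond N A B \<longleftrightarrow> \<Union>N \<inter> A = {} \<or> (\<exists>S\<in>N. S \<inter> A \<noteq> {} \<and> S \<inter> A \<subseteq> B)"

lemma truth_set_Cf:
  "truth_set W \<S> v (\<phi> \<box>\<rightarrow> \<psi>) =
     {w \<in> W. sphere_cond (\<S> w) (truth_set W \<S> v \<phi>) (truth_set W \<S> v \<psi>)}"
  by (simp add: sphere_cond_def)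

lemma truth_set_subset:
  assumes "sphere_model W \<S> v"
  shows "truth_set W \<S> v \<phi> \<subseteq> W"
proof (induction \<phi>)
  case (Var p)
  then show ?case using assms by (simp add: sphere_model_def)
qed auto

lemma sphere_model_chain: "sphere_model W \<S> v \<Longrightarrow> w \<in> W \<Longrightarrow> chain\<^sub>\<subseteq> (\<S> w)"
  by (simp add: sphere_model_def chain_subset_def)

lemma sphere_model_Union: "sphere_model W \<S> v \<Longrightarrow> w \<in> W \<Longrightarrow> \<Union>(\<S> w) \<subseteq> W"
  by (auto simp: sphere_model_def)

lemma sphere_cond_refl: "sphere_cond N A A"
  by (auto simp: sphere_cond_def)

lemma sphere_cond_mono:
  "sphere_cond N A B \<Longrightarrow> \<Union>N \<inter> B \<subseteq> C \<Longrightarrow> sphere_cond N A C"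
  unfolding sphere_cond_def by blast

text \<open>Of two nested witnessing spheres the smaller serves both consequents; this validates
  L4.\<close>

lemma sphere_cond_Int:
  assumes "chain\<^sub>\<subseteq> N"
  shows "sphere_cond N A (B \<inter> C) \<longleftrightarrow> sphere_cond N A B \<and> sphere_cond N A C"
proof
  assume "sphere_cond N A B \<and> sphere_cond N A C"
  then consider "\<Union>N \<inter> A = {}"
    | S T where "S \<in> N" "S \<inter> A \<noteq> {}" "S \<inter> A \<subseteq> B" "T \<in> N" "T \<inter> A \<noteq> {}" "T \<inter> A \<subseteq> C"
    unfolding sphere_cond_def by blast
  then show "sphere_cond N A (B \<inter> C)"
  proof cases
    case 2
    then have "S \<subseteq> T \<or> T \<subseteq> S" using assms by (simp add: chain_subset_def)
    with 2 show ?thesis unfolding sphere_cond_def by blast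
  qed (simp add: sphere_cond_def)
qed (auto simp: sphere_cond_def)

text \<open>Validates L2. One sphere \<open>S\<close> witnesses \<open>A\<close> against
  \<open>B \<inter> C\<close>, another \<open>T\<close> witnesses \<open>B\<close> against
  \<open>A\<close>; the smaller of the two witnesses \<open>B\<close> against
  \<open>C\<close>.\<close>

lemma sphere_cond_swap:
  assumes "chain\<^sub>\<subseteq> N" "sphere_cond N A B" "sphere_cond N B A" "sphere_cond N A C"
  shows "sphere_cond N B C"
proof (cases "\<Union>N \<inter> B = {}")
  case False
  with assms(3) have "\<Union>N \<inter> A \<noteq> {}" unfolding sphere_cond_def by blast
  moreover have "sphere_cond N A (B \<inter> C)"
    using assms by (simp add: sphere_cond_Int)
  ultimately obtain S where S: "S \<in> N" "S \<inter> A \<noteq> {}" "S \<inter> A \<subseteq> B \<inter> C"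
    unfolding sphere_cond_def by blast
  obtain T where T: "T \<in> N" "T \<inter> B \<noteq> {}" "T \<inter> B \<subseteq> A"
    using False assms(3) unfolding sphere_cond_def by blast
  have "S \<subseteq> T \<or> T \<subseteq> S" using assms(1) S T by (simp add: chain_subset_def)
  then show ?thesis using S T unfolding sphere_cond_def by blast
qed (simp add: sphere_cond_def)

text \<open>Validates L3. A sphere meeting \<open>A \<union> B\<close> but missing one of the two
  sets would witness one of the excluded conditionals. So every sphere that meets the union meets
  both sets, and the smaller of two witnesses works for the union.\<close>

lemma sphere_cond_Un:
  assumes chain: "chain\<^sub>\<subseteq> N" and A: "\<not> sphere_cond N (A \<union> B) A" and B: "\<not> sphere_cond N (A \<union> B) B"
  shows "sphere_cond N (A \<union> B) C \<longleftrightarrow> sphere_cond N A C \<and> sphere_cond N B C"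
proof -
  have meets: "S \<inter> A \<noteq> {} \<and> S \<inter> B \<noteq> {}" if "S \<in> N" "S \<inter> (A \<union> B) \<noteq> {}" for S
    using that A B unfolding sphere_cond_def by blast
  have ne: "\<Union>N \<inter> (A \<union> B) \<noteq> {}" using A unfolding sphere_cond_def by blast
  show ?thesis
  proof
    assume "sphere_cond N (A \<union> B) C"
    with ne obtain S where S: "S \<in> N" "S \<inter> (A \<union> B) \<noteq> {}" "S \<inter> (A \<union> B) \<subseteq> C"
      unfolding sphere_cond_def by blast
    moreover have "S \<inter> A \<noteq> {}" "S \<inter> B \<noteq> {}" "S \<inter> A \<subseteq> C" "S \<inter> B \<subseteq> C"
      using meets[OF S(1,2)] S(3) by auto
    ultimately show "sphere_cond N A C \<and> sphere_cond N B C"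
      unfolding sphere_cond_def by metis
  next
    assume "sphere_cond N A C \<and> sphere_cond N B C"
    moreover have "\<Union>N \<inter> A \<noteq> {}" "\<Union>N \<inter> B \<noteq> {}" using ne meets by blast+
    ultimately obtain S T where S: "S \<in> N" "S \<inter> A \<noteq> {}" "S \<inter> A \<subseteq> C"
      and T: "T \<in> N" "T \<inter> B \<noteq> {}" "T \<inter> B \<subseteq> C"
      unfolding sphere_cond_def by blast
    have "S \<subseteq> T \<or> T \<subseteq> S" using chain S T by (simp add: chain_subset_def)
    then show "sphere_cond N (A \<union> B) C"
    proof
      assume "S \<subseteq> T"
      then have "S \<inter> (A \<union> B) \<noteq> {}" "S \<inter> (A \<union> B) \<subseteq> C" using S T by blast+
      with S show ?thesis unfolding sphere_cond_def by blast
    next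
      assume "T \<subseteq> S"
      then have "T \<inter> (A \<union> B) \<noteq> {}" "T \<inter> (A \<union> B) \<subseteq> C" using S T by blast+
      with T show ?thesis unfolding sphere_cond_def by blast
    qed
  qed
qed

lemma classical_axiom_sound:
  assumes "classical_axiom \<phi>" "w \<in> W"
  shows "w \<in> truth_set W \<S> v \<phi>"
  using assms by cases auto

lemma V_axiom_sound:
  assumes model: "sphere_model W \<S> v" and "V_axiom \<phi>" and w: "w \<in> W"
  shows "w \<in> truth_set W \<S> v \<phi>"
proof -
  note chain = sphere_model_chain[OF model w]
  from assms(2) show ?thesis
  proof cases
    case Cl
    then show ?thesis using w by (rule classical_axiom_sound)
  next
    case L1
    then show ?thesis using w by (simp add: truth_set_Cf sphere_cond_refl del: truth_set.simps(7))
  next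
    case (L2 a b c)
    let ?t = "truth_set W \<S> v"
    have "sphere_cond (\<S> w) (?t a) (?t c) \<longleftrightarrow> sphere_cond (\<S> w) (?t b) (?t c)"
      if "sphere_cond (\<S> w) (?t a) (?t b)" "sphere_cond (\<S> w) (?t b) (?t a)"
      using that sphere_cond_swap[OF chain] by metis
    then show ?thesis
      unfolding L2 using w by (simp add: truth_set_Cf del: truth_set.simps(7))
  next
    case (L3 a b c)
    show ?thesis
      unfolding L3 using w sphere_cond_Un[OF chain, of "truth_set W \<S> v a" "truth_set W \<S> v b"]
      by (simp add: truth_set_Cf del: truth_set.simps(7)) metis
  next
    case (L4 a b c)
    show ?thesis
      unfolding L4 using w
      by (simp add: truth_set_Cf sphere_cond_Int[OF chain] del: truth_set.simps(7))
  qed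
qed

lemma GV_deriv_sound:
  assumes model: "sphere_model W \<S> v" and hyp: "\<forall>\<gamma>\<in>\<Gamma>. W \<subseteq> truth_set W \<S> v \<gamma>"
    and "GV_deriv \<Gamma> \<phi>"
  shows "W \<subseteq> truth_set W \<S> v \<phi>"
  using assms(3)
proof (induction rule: GV_deriv.induct)
  case (hyp \<phi>)
  then show ?case using assms(2) by blast
next
  case (ax \<phi>)
  then show ?case using V_axiom_sound[OF model] by blast
next
  case (MP \<phi> \<psi>)
  then show ?case by auto
next
  case (C \<phi> \<psi> \<gamma>)
  have "sphere_cond (\<S> w) (truth_set W \<S> v \<gamma>) (truth_set W \<S> v \<psi>)"
    if "w \<in> W" "sphere_cond (\<S> w) (truth_set W \<S> v \<gamma>) (truth_set W \<S> v \<phi>)" for w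
    using that(2)
  proof (rule sphere_cond_mono)
    show "\<Union>(\<S> w) \<inter> truth_set W \<S> v \<phi> \<subseteq> truth_set W \<S> v \<psi>"
      using C.IH sphere_model_Union[OF model that(1)] by auto
  qed
  then show ?case by (auto simp: truth_set_Cf simp del: truth_set.simps(7))
qed

text \<open>Rule (C) preserves truth at all worlds, not truth at a fixed one. It enters here only
  through theorems, which are covered by global soundness without premises.\<close>

lemma LV_deriv_sound:
  assumes model: "sphere_model W \<S> v" and w: "w \<in> W" and hyp: "\<forall>\<gamma>\<in>\<Gamma>. w \<in> truth_set W \<S> v \<gamma>"
    and "LV_deriv \<Gamma> \<phi>"
  shows "w \<in> truth_set W \<S> v \<phi>"
  using assms(4)
proof (induction rule: LV_deriv.induct)
  case (hyp \<phi>)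
  then show ?case using assms(3) by blast
next
  case (thmI \<phi>)
  then show ?case using GV_deriv_sound[OF model _ thmI] w by blast
next
  case (MP \<phi> \<psi>)
  then show ?case by auto
qed


section \<open>Maximal consistent sets\<close>

lemma LV_deriv_classical: "classical_axiom \<phi> \<Longrightarrow> LV_deriv \<Gamma> \<phi>"
  by (intro LV_deriv.thmI GV_deriv.ax V_axiom.Cl)

lemma LV_deriv_const: "LV_deriv \<Gamma> \<psi> \<Longrightarrow> LV_deriv \<Gamma> (\<phi> \<^bold>\<rightarrow> \<psi>)"
  by (erule LV_deriv.MP) (rule LV_deriv_classical, rule classical_axiom.intros(1))

lemma LV_deriv_S:
  assumes "LV_deriv \<Gamma> (\<phi> \<^bold>\<rightarrow> (\<psi> \<^bold>\<rightarrow> \<chi>))" "LV_deriv \<Gamma> (\<phi> \<^bold>\<rightarrow> \<psi>)"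
  shows "LV_deriv \<Gamma> (\<phi> \<^bold>\<rightarrow> \<chi>)"
  using assms(2)
  by (rule LV_deriv.MP)
    (rule LV_deriv.MP[OF assms(1)], rule LV_deriv_classical, rule classical_axiom.intros(2))

lemma LV_deriv_id: "LV_deriv \<Gamma> (\<phi> \<^bold>\<rightarrow> \<phi>)"
  by (rule LV_deriv_S[where \<psi> = "\<phi> \<^bold>\<rightarrow> \<phi>"])
    (rule LV_deriv_classical, rule classical_axiom.intros(1))+

text \<open>Works because modus ponens is the only rule that \<open>LV_deriv\<close> applies to
  hypotheses; (C) is confined to theorems. This is why maximal consistent sets are built from
  \<open>LV_deriv\<close>, even for GV.\<close>

lemma LV_deduction:
  assumes "LV_deriv (insert \<phi> \<Gamma>) \<psi>"
  shows "LV_deriv \<Gamma> (\<phi> \<^bold>\<rightarrow> \<psi>)"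
  using assms
proof (induction rule: LV_deriv.induct)
  case (hyp \<psi>)
  then show ?case by (auto intro: LV_deriv_id LV_deriv_const LV_deriv.hyp)
next
  case (thmI \<psi>)
  then show ?case by (intro LV_deriv_const LV_deriv.thmI)
next
  case (MP \<psi> \<chi>)
  show ?case using MP.IH(2,1) by (rule LV_deriv_S)
qed

lemma LV_deriv_cases:
  assumes "LV_deriv \<Gamma> (\<phi> \<^bold>\<rightarrow> \<chi>)" "LV_deriv \<Gamma> (\<psi> \<^bold>\<rightarrow> \<chi>)" "LV_deriv \<Gamma> (\<phi> \<^bold>\<or> \<psi>)"
  shows "LV_deriv \<Gamma> \<chi>"
proof -
  have "LV_deriv \<Gamma> ((\<phi> \<^bold>\<rightarrow> \<chi>) \<^bold>\<rightarrow> ((\<psi> \<^bold>\<rightarrow> \<chi>) \<^bold>\<rightarrow> ((\<phi> \<^bold>\<or> \<psi>) \<^bold>\<rightarrow> \<chi>)))"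
    by (rule LV_deriv_classical, rule classical_axiom.intros)
  then show ?thesis using assms by (meson LV_deriv.MP)
qed

definition maximal_consistent :: "fm set \<Rightarrow> bool" where
  "maximal_consistent u \<longleftrightarrow>
     (\<forall>\<phi>. LV_deriv u \<phi> \<longrightarrow> \<phi> \<in> u) \<and> \<^bold>0 \<notin> u \<and> (\<forall>\<phi>. \<phi> \<in> u \<or> \<^bold>\<not> \<phi> \<in> u)"

text \<open>Zorn's lemma for the supersets of \<open>\<Gamma>\<close> that do not derive
  \<open>\<phi>\<close>; finitariness keeps unions of chains among them.\<close>

lemma Lindenbaum:
  assumes "\<not> LV_deriv \<Gamma> \<phi>"
  obtains u where "maximal_consistent u" "\<Gamma> \<subseteq> u" "\<phi> \<notin> u"
proof -
  let ?A = "{Y. \<Gamma> \<subseteq> Y \<and> \<not> LV_deriv Y \<phi>}"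
  have "\<exists>M\<in>?A. \<forall>X\<in>?A. M \<subseteq> X \<longrightarrow> X = M"
  proof (rule subset_Zorn_nonempty)
    show "?A \<noteq> {}" using assms by blast
  next
    fix \<C> assume ne: "\<C> \<noteq> {}" and chain: "subset.chain ?A \<C>"
    then have sub: "\<C> \<subseteq> ?A" by (simp add: subset.chain_def)
    have "\<not> LV_deriv (\<Union>\<C>) \<phi>"
    proof
      assume "LV_deriv (\<Union>\<C>) \<phi>"
      then obtain F where F: "finite F" "F \<subseteq> \<Union>\<C>" "LV_deriv F \<phi>"
        using LV_deriv_finitary by blast
      then obtain Y where "Y \<in> \<C>" "F \<subseteq> Y"
        using finite_subset_Union_chain[OF F(1,2) ne chain] by blast
      then show False using F(3) sub LV_deriv_mono by blast
    qed
    then show "\<Union>\<C> \<in> ?A" using ne sub by blast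
  qed
  then obtain u where u: "\<Gamma> \<subseteq> u" "\<not> LV_deriv u \<phi>"
    and max: "\<And>X. u \<subseteq> X \<Longrightarrow> \<not> LV_deriv X \<phi> \<Longrightarrow> X = u"
    by (smt (verit) mem_Collect_eq subset_trans)
  \<comment> \<open>By maximality, adding any missing formula makes \<open>\<phi>\<close> derivable.
    Excluded middle then forces one of each formula and its negation into \<open>u\<close>.\<close>
  have imp: "LV_deriv u (\<chi> \<^bold>\<rightarrow> \<phi>)" if "\<chi> \<notin> u" for \<chi>
    using that max[of "insert \<chi> u"] by (blast intro: LV_deduction)
  have "maximal_consistent u"
    unfolding maximal_consistent_def
  proof (intro conjI allI impI)
    show "\<chi> \<in> u" if "LV_deriv u \<chi>" for \<chi>
      using LV_deriv.MP[OF that] imp u(2) by blast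
    show "\<^bold>0 \<notin> u"
      using LV_deriv.MP[of u "\<^bold>0" \<phi>] LV_deriv.hyp[of _ u] u(2)
        LV_deriv_classical[OF classical_axiom.intros(9)] by blast
    show "\<chi> \<in> u \<or> \<^bold>\<not> \<chi> \<in> u" for \<chi>
      using LV_deriv_cases[OF imp imp LV_deriv_classical[OF classical_axiom.intros(11)]] u(2)
      by blast
  qed
  moreover have "\<phi> \<notin> u" using u(2) LV_deriv.hyp by blast
  ultimately show thesis using u(1) that by blast
qed

lemma maximal_consistent_thm:
  "maximal_consistent u \<Longrightarrow> GV_deriv {} \<phi> \<Longrightarrow> \<phi> \<in> u"
  unfolding maximal_consistent_def by (blast intro: LV_deriv.thmI)

lemma maximal_consistent_mp:
  "maximal_consistent u \<Longrightarrow> \<phi> \<^bold>\<rightarrow> \<psi> \<in> u \<Longrightarrow> \<phi> \<in> u \<Longrightarrow> \<psi> \<in> u"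
  unfolding maximal_consistent_def by (blast intro: LV_deriv.MP LV_deriv.hyp)

lemma maximal_consistent_classical:
  "maximal_consistent u \<Longrightarrow> classical_axiom \<phi> \<Longrightarrow> \<phi> \<in> u"
  unfolding maximal_consistent_def by (blast intro: LV_deriv_classical)

lemma maximal_consistent_Zero: "maximal_consistent u \<Longrightarrow> \<^bold>0 \<notin> u"
  by (simp add: maximal_consistent_def)

lemma maximal_consistent_Impl:
  assumes u: "maximal_consistent u"
  shows "\<phi> \<^bold>\<rightarrow> \<psi> \<in> u \<longleftrightarrow> (\<phi> \<in> u \<longrightarrow> \<psi> \<in> u)"
proof
  assume r: "\<phi> \<in> u \<longrightarrow> \<psi> \<in> u"
  have "LV_deriv u (\<phi> \<^bold>\<rightarrow> \<psi>)"
  proof (cases "\<phi> \<in> u")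
    case True
    then show ?thesis using r by (blast intro: LV_deriv_const LV_deriv.hyp)
  next
    case False
    then have "\<^bold>\<not> \<phi> \<in> u" using u by (auto simp: maximal_consistent_def)
    then have "LV_deriv (insert \<phi> u) \<^bold>0"
      using LV_deriv.MP[of "insert \<phi> u" \<phi> "\<^bold>0"] LV_deriv.hyp by blast
    then show ?thesis
      by (intro LV_deduction)
        (erule LV_deriv.MP, rule LV_deriv_classical, rule classical_axiom.intros(9))
  qed
  then show "\<phi> \<^bold>\<rightarrow> \<psi> \<in> u" using u by (simp add: maximal_consistent_def)
qed (use maximal_consistent_mp[OF u] in blast)

lemma maximal_consistent_One: "maximal_consistent u \<Longrightarrow> \<^bold>1 \<in> u"
  by (rule maximal_consistent_classical) (auto intro: classical_axiom.intros)

lemma maximal_consistent_Conj: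
  assumes u: "maximal_consistent u"
  shows "\<phi> \<^bold>\<and> \<psi> \<in> u \<longleftrightarrow> \<phi> \<in> u \<and> \<psi> \<in> u"
  using maximal_consistent_classical[OF u classical_axiom.intros(3), of \<phi> \<psi>]
    maximal_consistent_classical[OF u classical_axiom.intros(4), of \<phi> \<psi>]
    maximal_consistent_classical[OF u classical_axiom.intros(5), of \<phi> \<psi>]
  by (auto simp: maximal_consistent_Impl[OF u])

lemma maximal_consistent_Disj:
  assumes u: "maximal_consistent u"
  shows "\<phi> \<^bold>\<or> \<psi> \<in> u \<longleftrightarrow> \<phi> \<in> u \<or> \<psi> \<in> u"
  using maximal_consistent_classical[OF u classical_axiom.intros(6), of \<phi> \<psi>]
    maximal_consistent_classical[OF u classical_axiom.intros(7), of \<psi> \<phi>]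
    maximal_consistent_classical[OF u classical_axiom.intros(8), of \<phi> "\<^bold>0" \<psi>]
  by (auto simp: maximal_consistent_Impl[OF u] maximal_consistent_Zero[OF u])

lemmas maximal_consistent_simps =
  maximal_consistent_Zero maximal_consistent_One maximal_consistent_Conj
  maximal_consistent_Disj maximal_consistent_Impl


section \<open>The canonical model\<close>

text \<open>Containing \<open>G\<close> would not be enough: maximal consistent sets are closed
  under \<open>LV_deriv\<close>, which does not apply (C) to members of \<open>G\<close>.\<close>

definition worlds :: "fm set \<Rightarrow> fm set set" where
  "worlds G = {u. maximal_consistent u \<and> Collect (GV_deriv G) \<subseteq> u}"

lemma worlds_simps [simp]:
  assumes "u \<in> worlds G"
  shows "\<^bold>0 \<notin> u" "\<^bold>1 \<in> u" "\<phi> \<^bold>\<and> \<psi> \<in> u \<longleftrightarrow> \<phi> \<in> u \<and> \<psi> \<in> u"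
    "\<phi> \<^bold>\<or> \<psi> \<in> u \<longleftrightarrow> \<phi> \<in> u \<or> \<psi> \<in> u" "\<phi> \<^bold>\<rightarrow> \<psi> \<in> u \<longleftrightarrow> (\<phi> \<in> u \<longrightarrow> \<psi> \<in> u)"
  using assms by (simp_all add: worlds_def maximal_consistent_simps)

lemma worlds_thm: "u \<in> worlds G \<Longrightarrow> GV_deriv G \<phi> \<Longrightarrow> \<phi> \<in> u"
  by (auto simp: worlds_def)

text \<open>Makes \<open>Lindenbaum\<close>, which speaks of \<open>LV_deriv\<close>, applicable to
  underivability in GV.\<close>

lemma LV_deriv_GV_deriv:
  assumes "LV_deriv (Collect (GV_deriv G)) \<phi>"
  shows "GV_deriv G \<phi>"
  using assms
proof (induction rule: LV_deriv.induct)
  case (thmI \<phi>)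
  then show ?case by (rule GV_deriv_mono) simp
next
  case (MP \<phi> \<psi>)
  show ?case using MP.IH by (rule GV_deriv.MP)
qed simp

text \<open>Replaces classical derivations in the calculus by membership arguments over worlds,
  which \<open>worlds_simps\<close> settles automatically.\<close>

lemma GV_deriv_iff_worlds: "GV_deriv G \<phi> \<longleftrightarrow> (\<forall>u\<in>worlds G. \<phi> \<in> u)"
proof
  assume all: "\<forall>u\<in>worlds G. \<phi> \<in> u"
  show "GV_deriv G \<phi>"
  proof (rule ccontr)
    assume "\<not> GV_deriv G \<phi>"
    then have "\<not> LV_deriv (Collect (GV_deriv G)) \<phi>" using LV_deriv_GV_deriv by blast
    then show False by (rule Lindenbaum) (use all in \<open>auto simp: worlds_def\<close>)
  qed
qed (simp add: worlds_thm)

section \<open>The conditional at a fixed world as a rational consequence relation\<close>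

locale canonical_world =
  fixes G w
  assumes w: "w \<in> worlds G"
begin

definition cond :: "fm \<Rightarrow> fm \<Rightarrow> bool" (infix \<open>\<leadsto>\<close> 50) where
  "\<phi> \<leadsto> \<psi> \<longleftrightarrow> \<phi> \<box>\<rightarrow> \<psi> \<in> w"

lemma axiom: "V_axiom \<phi> \<Longrightarrow> \<phi> \<in> w"
  using w by (blast intro: worlds_thm GV_deriv.ax)

text \<open>Right weakening. The implication is derivable from \<open>G\<close>, so (C) applies to
  it, and \<open>w\<close> contains whatever GV derives from \<open>G\<close>.\<close>

lemma cond_mono:
  assumes "\<gamma> \<leadsto> \<phi>" "\<And>u. u \<in> worlds G \<Longrightarrow> \<phi> \<in> u \<Longrightarrow> \<psi> \<in> u"
  shows "\<gamma> \<leadsto> \<psi>"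
proof -
  have "GV_deriv G (\<phi> \<^bold>\<rightarrow> \<psi>)" using assms(2) by (simp add: GV_deriv_iff_worlds)
  then have "(\<gamma> \<box>\<rightarrow> \<phi>) \<^bold>\<rightarrow> (\<gamma> \<box>\<rightarrow> \<psi>) \<in> w" using w by (blast intro: worlds_thm GV_deriv.C)
  then show ?thesis using assms(1) w by (simp add: cond_def)
qed

lemma cond_refl: "\<phi> \<leadsto> \<phi>"
  by (simp add: cond_def axiom V_axiom.L1)

lemma cond_le:
  assumes "\<And>u. u \<in> worlds G \<Longrightarrow> \<phi> \<in> u \<Longrightarrow> \<psi> \<in> u"
  shows "\<phi> \<leadsto> \<psi>"
  using cond_refl assms by (rule cond_mono)

lemma cond_conj: "\<phi> \<leadsto> \<psi> \<Longrightarrow> \<phi> \<leadsto> \<chi> \<Longrightarrow> \<phi> \<leadsto> \<psi> \<^bold>\<and> \<chi>"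
  using axiom[OF V_axiom.L4[of \<phi> \<psi> \<chi>]] w by (simp add: cond_def)

lemma cond_swap: "\<phi> \<leadsto> \<psi> \<Longrightarrow> \<psi> \<leadsto> \<phi> \<Longrightarrow> \<phi> \<leadsto> \<chi> \<Longrightarrow> \<psi> \<leadsto> \<chi>"
  using axiom[OF V_axiom.L2[of \<phi> \<psi> \<chi>]] w by (simp add: cond_def)

lemma cond_cong:
  assumes "\<phi> \<leadsto> \<chi>" "\<And>u. u \<in> worlds G \<Longrightarrow> \<phi> \<in> u \<longleftrightarrow> \<psi> \<in> u"
  shows "\<psi> \<leadsto> \<chi>"
  by (rule cond_swap[OF _ _ assms(1)]; rule cond_le) (simp_all add: assms(2))

lemma cond_disj_cases:
  "\<phi> \<^bold>\<or> \<psi> \<leadsto> \<phi> \<or> \<phi> \<^bold>\<or> \<psi> \<leadsto> \<psi> \<or> (\<phi> \<^bold>\<or> \<psi> \<leadsto> \<chi> \<longleftrightarrow> \<phi> \<leadsto> \<chi> \<and> \<psi> \<leadsto> \<chi>)"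
  using axiom[OF V_axiom.L3[of \<phi> \<psi> \<chi>]] w by (auto simp: cond_def)

text \<open>Cautious monotony: as \<open>\<psi>\<close> entails \<open>\<phi>\<close>, the converse
  conditional is automatic and L2 exchanges the antecedents.\<close>

lemma cond_cautious:
  assumes "\<phi> \<leadsto> \<psi>" "\<phi> \<leadsto> \<chi>" "\<And>u. u \<in> worlds G \<Longrightarrow> \<psi> \<in> u \<Longrightarrow> \<phi> \<in> u"
  shows "\<psi> \<leadsto> \<chi>"
  using assms(1) cond_le[OF assms(3)] assms(2) by (rule cond_swap)

text \<open>The Or rule. The last case of L3 is immediate; in the other two the disjunction and one
  disjunct imply each other counterfactually, so L2 transfers the consequent.\<close>

lemma cond_disj:
  assumes "\<phi> \<leadsto> \<chi>" "\<psi> \<leadsto> \<chi>"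
  shows "\<phi> \<^bold>\<or> \<psi> \<leadsto> \<chi>"
proof -
  have "\<phi> \<leadsto> \<phi> \<^bold>\<or> \<psi>" "\<psi> \<leadsto> \<phi> \<^bold>\<or> \<psi>" by (rule cond_le; simp)+
  then show ?thesis using cond_disj_cases[of \<phi> \<psi> \<chi>] assms cond_swap by blast
qed

text \<open>Rational monotony, from L3 for the split of \<open>\<phi>\<close> into its
  \<open>\<psi>\<close> part and its \<open>\<not> \<psi>\<close> part. The first case of L3 reduces
  to cautious monotony, the second contradicts the assumption, and the third gives the
  claim.\<close>

lemma cond_rational:
  assumes "\<phi> \<leadsto> \<chi>" "\<not> \<phi> \<leadsto> \<^bold>\<not> \<psi>"
  shows "\<phi> \<^bold>\<and> \<psi> \<leadsto> \<chi>"
proof -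
  let ?a = "\<phi> \<^bold>\<and> \<psi>" and ?b = "\<phi> \<^bold>\<and> \<^bold>\<not> \<psi>"
  have eq: "?a \<^bold>\<or> ?b \<leadsto> \<gamma> \<longleftrightarrow> \<phi> \<leadsto> \<gamma>" for \<gamma>
    by (rule iffI; erule cond_cong; auto)
  have "\<not> \<phi> \<leadsto> ?b" using assms(2) cond_mono[of \<phi> ?b "\<^bold>\<not> \<psi>"] by auto
  then consider "\<phi> \<leadsto> ?a" | "?a \<leadsto> \<chi>"
    using cond_disj_cases[of ?a ?b \<chi>] assms(1) unfolding eq by blast
  then show ?thesis
  proof cases
    case 1
    then show ?thesis using assms(1) by (rule cond_cautious) simp
  qed
qed

section \<open>The possibility ranking of formulas\<close>

text \<open>Reads ``\<open>\<phi>\<close> is less possible than \<open>\<chi>\<close>''; it also holds when neither of them is possible.\<close>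

definition less :: "fm \<Rightarrow> fm \<Rightarrow> bool" (infix \<open>\<prec>\<close> 50) where
  "\<phi> \<prec> \<chi> \<longleftrightarrow> \<chi> \<^bold>\<or> \<phi> \<leadsto> \<^bold>\<not> \<phi>"

text \<open>What \<open>\<epsilon>\<close> adds to \<open>\<chi> \<or> \<phi>\<close> lies outside
  \<open>\<phi>\<close>, so the Or rule extends the exclusion of \<open>\<phi>\<close> to all of
  \<open>\<epsilon>\<close>. This brings several comparisons under one antecedent.\<close>

lemma cond_widen:
  assumes "\<phi> \<prec> \<chi>" "\<And>u. u \<in> worlds G \<Longrightarrow> \<chi> \<in> u \<Longrightarrow> \<epsilon> \<in> u"
    "\<And>u. u \<in> worlds G \<Longrightarrow> \<phi> \<in> u \<Longrightarrow> \<epsilon> \<in> u"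
  shows "\<epsilon> \<leadsto> \<^bold>\<not> \<phi>"
proof -
  let ?x = "\<chi> \<^bold>\<or> \<phi>"
  have "\<epsilon> \<^bold>\<and> \<^bold>\<not> ?x \<leadsto> \<^bold>\<not> \<phi>" by (rule cond_le) simp
  with assms(1) have "?x \<^bold>\<or> (\<epsilon> \<^bold>\<and> \<^bold>\<not> ?x) \<leadsto> \<^bold>\<not> \<phi>"
    unfolding less_def by (rule cond_disj)
  then show ?thesis by (rule cond_cong) (use assms(2,3) in auto)
qed

text \<open>Together with \<open>less_mono\<close> this makes the formulas less possible than
  \<open>\<chi>\<close> an ideal.\<close>

lemma less_disj:
  assumes "\<phi> \<prec> \<chi>" "\<psi> \<prec> \<chi>"
  shows "\<phi> \<^bold>\<or> \<psi> \<prec> \<chi>"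
proof -
  let ?e = "\<chi> \<^bold>\<or> (\<phi> \<^bold>\<or> \<psi>)"
  have "?e \<leadsto> \<^bold>\<not> \<phi>" "?e \<leadsto> \<^bold>\<not> \<psi>"
    using assms by (auto elim!: cond_widen)
  then have "?e \<leadsto> \<^bold>\<not> \<phi> \<^bold>\<and> \<^bold>\<not> \<psi>" by (rule cond_conj)
  then show ?thesis unfolding less_def by (rule cond_mono) auto
qed

text \<open>Excluding \<open>\<psi>\<close> under \<open>\<chi> \<or> \<psi>\<close> leaves
  \<open>\<chi>\<close>, so cautious monotony may shrink the antecedent to
  \<open>\<chi> \<or> \<phi>\<close>.\<close>

lemma less_mono:
  assumes "\<psi> \<prec> \<chi>" "\<And>u. u \<in> worlds G \<Longrightarrow> \<phi> \<in> u \<Longrightarrow> \<psi> \<in> u"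
  shows "\<phi> \<prec> \<chi>"
  unfolding less_def
proof (rule cond_cautious)
  have "\<chi> \<^bold>\<or> \<psi> \<leadsto> (\<chi> \<^bold>\<or> \<psi>) \<^bold>\<and> \<^bold>\<not> \<psi>"
    using assms(1) unfolding less_def by (intro cond_conj cond_refl)
  then show "\<chi> \<^bold>\<or> \<psi> \<leadsto> \<chi> \<^bold>\<or> \<phi>" by (rule cond_mono) auto
  show "\<chi> \<^bold>\<or> \<psi> \<leadsto> \<^bold>\<not> \<phi>"
    using assms(1) unfolding less_def by (rule cond_mono) (use assms(2) in auto)
qed (use assms(2) in auto)

text \<open>The modularity of the ranking, where rational monotony is used: it shrinks the join of
  all three formulas to \<open>\<chi> \<or> \<phi>\<close>.\<close>

lemma less_trans_not_less:
  assumes "\<phi> \<prec> \<psi>" "\<not> \<chi> \<prec> \<psi>"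
  shows "\<phi> \<prec> \<chi>"
proof -
  let ?e = "(\<psi> \<^bold>\<or> \<chi>) \<^bold>\<or> \<phi>"
  have a: "?e \<leadsto> \<^bold>\<not> \<phi>" using assms(1) by (rule cond_widen) auto
  \<comment> \<open>Otherwise \<open>\<chi>\<close> would be excluded under \<open>?e\<close>. As
    \<open>\<phi>\<close> is excluded too, cautious monotony would shrink \<open>?e\<close> to
    \<open>\<psi> \<or> \<chi>\<close> and yield \<open>\<chi> \<prec> \<psi>\<close>.\<close>
  have "\<not> ?e \<leadsto> \<^bold>\<not> (\<chi> \<^bold>\<or> \<phi>)"
  proof
    assume "?e \<leadsto> \<^bold>\<not> (\<chi> \<^bold>\<or> \<phi>)"
    then have c: "?e \<leadsto> \<^bold>\<not> \<chi>" by (rule cond_mono) auto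
    have "?e \<leadsto> ?e \<^bold>\<and> \<^bold>\<not> \<phi>" using a by (intro cond_conj cond_refl)
    then have "?e \<leadsto> \<psi> \<^bold>\<or> \<chi>" by (rule cond_mono) auto
    then have "\<psi> \<^bold>\<or> \<chi> \<leadsto> \<^bold>\<not> \<chi>" using c by (rule cond_cautious) auto
    with assms(2) show False by (simp add: less_def)
  qed
  with a have "?e \<^bold>\<and> (\<chi> \<^bold>\<or> \<phi>) \<leadsto> \<^bold>\<not> \<phi>" by (rule cond_rational)
  then show ?thesis unfolding less_def by (rule cond_cong) auto
qed

text \<open>Under the disjunction both disjuncts are excluded, so it is impossible, and cautious
  monotony passes this on to \<open>\<phi>\<close>. Hence the ranking is asymmetric on possible
  formulas.\<close>

lemma less_asym:
  assumes "\<phi> \<prec> \<psi>" "\<psi> \<prec> \<phi>"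
  shows "\<phi> \<leadsto> \<^bold>0"
proof -
  let ?e = "\<phi> \<^bold>\<or> \<psi>"
  have "?e \<leadsto> \<^bold>\<not> \<phi>" "?e \<leadsto> \<^bold>\<not> \<psi>" using assms by (auto elim!: cond_widen)
  then have "?e \<leadsto> ?e \<^bold>\<and> (\<^bold>\<not> \<phi> \<^bold>\<and> \<^bold>\<not> \<psi>)" by (intro cond_conj cond_refl)
  then have zero: "?e \<leadsto> \<^bold>0" by (rule cond_mono) auto
  then have "?e \<leadsto> \<phi>" by (rule cond_mono) simp
  then show ?thesis using zero by (rule cond_cautious) simp
qed

text \<open>Recovers the conditional from the ranking: joining
  \<open>\<phi> \<and> \<not> \<psi>\<close> to \<open>\<phi>\<close> changes nothing, so the
  comparison has antecedent \<open>\<phi>\<close> up to equivalence.\<close>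

lemma cond_iff_less: "\<phi> \<leadsto> \<psi> \<longleftrightarrow> \<phi> \<^bold>\<and> \<^bold>\<not> \<psi> \<prec> \<phi>"
proof
  assume "\<phi> \<leadsto> \<psi>"
  then have "\<phi> \<leadsto> \<^bold>\<not> (\<phi> \<^bold>\<and> \<^bold>\<not> \<psi>)" by (rule cond_mono) simp
  then show "\<phi> \<^bold>\<and> \<^bold>\<not> \<psi> \<prec> \<phi>" unfolding less_def by (rule cond_cong) auto
next
  assume "\<phi> \<^bold>\<and> \<^bold>\<not> \<psi> \<prec> \<phi>"
  then have "\<phi> \<leadsto> \<^bold>\<not> (\<phi> \<^bold>\<and> \<^bold>\<not> \<psi>)" unfolding less_def by (rule cond_cong) auto
  then have "\<phi> \<leadsto> \<phi> \<^bold>\<and> \<^bold>\<not> (\<phi> \<^bold>\<and> \<^bold>\<not> \<psi>)" by (intro cond_conj cond_refl)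
  then show "\<phi> \<leadsto> \<psi>" by (rule cond_mono) auto
qed

section \<open>Spheres from the ranking\<close>

definition sphere :: "fm \<Rightarrow> fm set set" where
  "sphere \<chi> = {u \<in> worlds G. \<forall>\<phi>. \<phi> \<prec> \<chi> \<longrightarrow> \<phi> \<notin> u}"

text \<open>A compactness argument: if the negations of all less possible formulas refuted
  \<open>\<phi>\<close>, then \<open>\<phi>\<close> would entail a single
  \<open>\<alpha> \<prec> \<chi>\<close>, and \<open>less_mono\<close> would give
  \<open>\<phi> \<prec> \<chi>\<close>.\<close>

lemma sphere_meets_iff: "(\<exists>u\<in>sphere \<chi>. \<phi> \<in> u) \<longleftrightarrow> \<not> \<phi> \<prec> \<chi>"
proof
  assume nless: "\<not> \<phi> \<prec> \<chi>"
  let ?X = "Collect (GV_deriv G) \<union> {\<^bold>\<not> \<alpha> | \<alpha>. \<alpha> \<prec> \<chi>}"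
  \<comment> \<open>The formula \<open>\<alpha>\<close> gathers, as one disjunction, the exclusions
    used in a derivation; it is \<open>0\<close> when none is used.\<close>
  have "\<exists>\<alpha>. \<alpha> \<prec> \<chi> \<and> (\<forall>u\<in>worlds G. \<alpha> \<in> u \<or> \<psi> \<in> u)" if "LV_deriv ?X \<psi>" for \<psi>
    using that
  proof (induction rule: LV_deriv.induct)
    case (hyp \<psi>)
    have "\<^bold>0 \<prec> \<chi>" unfolding less_def by (rule cond_le) simp
    with hyp show ?case by (fastforce simp: worlds_thm)
  next
    case (thmI \<psi>)
    then have "GV_deriv G \<psi>" by (rule GV_deriv_mono) simp
    moreover have "\<^bold>0 \<prec> \<chi>" unfolding less_def by (rule cond_le) simp
    ultimately show ?case using worlds_thm by blast
  next
    case (MP \<psi> \<psi>')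
    then obtain \<alpha> \<beta> where "\<alpha> \<prec> \<chi>" "\<beta> \<prec> \<chi>" "\<forall>u\<in>worlds G. \<alpha> \<in> u \<or> \<psi> \<in> u"
      "\<forall>u\<in>worlds G. \<beta> \<in> u \<or> \<psi> \<^bold>\<rightarrow> \<psi>' \<in> u" by blast
    then show ?case using less_disj by (intro exI[of _ "\<alpha> \<^bold>\<or> \<beta>"]) auto
  qed
  then have "\<not> LV_deriv ?X (\<^bold>\<not> \<phi>)"
    using nless less_mono[of _ \<chi> \<phi>] by fastforce
  then obtain u where u: "maximal_consistent u" "?X \<subseteq> u" "\<^bold>\<not> \<phi> \<notin> u" by (rule Lindenbaum)
  then have "u \<in> worlds G" by (simp add: worlds_def)
  moreover have "\<alpha> \<notin> u" if "\<alpha> \<prec> \<chi>" for \<alpha>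
  proof -
    have "\<^bold>\<not> \<alpha> \<in> u" using that u(2) by blast
    then show ?thesis using \<open>u \<in> worlds G\<close> by simp
  qed
  ultimately show "\<exists>u\<in>sphere \<chi>. \<phi> \<in> u" using u(3) by (auto simp: sphere_def)
qed (auto simp: sphere_def)

lemma sphere_Int_subset_iff:
  "sphere \<chi> \<inter> {u. \<phi> \<in> u} \<subseteq> {u. \<psi> \<in> u} \<longleftrightarrow> \<phi> \<^bold>\<and> \<^bold>\<not> \<psi> \<prec> \<chi>"
  using sphere_meets_iff[of \<chi> "\<phi> \<^bold>\<and> \<^bold>\<not> \<psi>"] by (auto simp: sphere_def)

lemma sphere_mono: "\<not> \<phi> \<prec> \<psi> \<Longrightarrow> sphere \<phi> \<subseteq> sphere \<psi>"
  using less_trans_not_less by (auto simp: sphere_def)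

text \<open>A possible \<open>\<chi>\<close> is not less possible than itself, so its sphere meets
  it and is nonempty. By \<open>less_asym\<close>, \<open>sphere_mono\<close> applies in at least
  one direction to two such formulas.\<close>

definition spheres :: "fm set set set" where
  "spheres = {sphere \<chi> | \<chi>. \<not> \<chi> \<leadsto> \<^bold>0}"

lemma not_less_self: "\<not> \<phi> \<leadsto> \<^bold>0 \<Longrightarrow> \<not> \<phi> \<prec> \<phi>"
  using less_asym by blast

lemma spheres_chain: "S \<in> spheres \<Longrightarrow> T \<in> spheres \<Longrightarrow> S \<subseteq> T \<or> T \<subseteq> S"
  using sphere_mono less_asym unfolding spheres_def by blast

lemma spheres_nonempty: "S \<in> spheres \<Longrightarrow> S \<noteq> {}"
  using sphere_meets_iff not_less_self unfolding spheres_def by blast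

lemma spheres_subset: "S \<in> spheres \<Longrightarrow> S \<subseteq> worlds G"
  by (auto simp: spheres_def sphere_def)

lemma sphere_cond_spheres:
  "sphere_cond spheres (worlds G \<inter> {u. \<phi> \<in> u}) (worlds G \<inter> {u. \<psi> \<in> u}) \<longleftrightarrow> \<phi> \<leadsto> \<psi>"
proof
  have sub: "S \<inter> (worlds G \<inter> A) = S \<inter> A" if "S \<in> spheres" for S A
    using spheres_subset[OF that] by blast
  show "\<phi> \<leadsto> \<psi>" if sc: "sphere_cond spheres (worlds G \<inter> {u. \<phi> \<in> u}) (worlds G \<inter> {u. \<psi> \<in> u})"
  proof (cases "\<phi> \<leadsto> \<^bold>0")
    case True
    then show ?thesis by (rule cond_mono) simp
  next
    case False
    then have "sphere \<phi> \<in> spheres" "\<exists>u\<in>sphere \<phi>. \<phi> \<in> u"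
      using sphere_meets_iff not_less_self by (auto simp: spheres_def)
    then have "\<Union>spheres \<inter> (worlds G \<inter> {u. \<phi> \<in> u}) \<noteq> {}"
      using spheres_subset by blast
    then obtain S where S: "S \<in> spheres" "S \<inter> {u. \<phi> \<in> u} \<noteq> {}" "S \<inter> {u. \<phi> \<in> u} \<subseteq> {u. \<psi> \<in> u}"
      using sc sub unfolding sphere_cond_def by (metis Int_subset_iff)
    from S(1) obtain \<chi> where "S = sphere \<chi>" unfolding spheres_def by blast
    with S have "\<exists>u\<in>sphere \<chi>. \<phi> \<in> u" "sphere \<chi> \<inter> {u. \<phi> \<in> u} \<subseteq> {u. \<psi> \<in> u}" by blast+
    then have "\<not> \<phi> \<prec> \<chi>" "\<phi> \<^bold>\<and> \<^bold>\<not> \<psi> \<prec> \<chi>"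
      by (simp_all add: sphere_meets_iff sphere_Int_subset_iff)
    \<comment> \<open>Modularity moves the comparison from the index \<open>\<chi>\<close> of the
      witnessing sphere to \<open>\<phi>\<close> itself.\<close>
    then show ?thesis using less_trans_not_less cond_iff_less by blast
  qed
  show "sphere_cond spheres (worlds G \<inter> {u. \<phi> \<in> u}) (worlds G \<inter> {u. \<psi> \<in> u})" if c: "\<phi> \<leadsto> \<psi>"
  proof (cases "\<phi> \<leadsto> \<^bold>0")
    case True
    \<comment> \<open>An impossible \<open>\<phi>\<close> is below every formula, so no sphere meets
      it and the conditional is vacuously true.\<close>
    have self: "\<phi> \<prec> \<phi>"
      unfolding less_def by (rule cond_cong[OF cond_mono[OF True]]) auto
    have "\<phi> \<prec> \<chi>" for \<chi>
      using self unfolding less_def[of \<phi> \<chi>] by (rule cond_widen) auto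
    then have "\<phi> \<notin> u" if "u \<in> sphere \<chi>" for u \<chi>
      using that sphere_meets_iff by blast
    then show ?thesis unfolding sphere_cond_def spheres_def by blast
  next
    case False
    then have mem: "sphere \<phi> \<in> spheres" and "\<exists>u\<in>sphere \<phi>. \<phi> \<in> u"
      using sphere_meets_iff not_less_self by (auto simp: spheres_def)
    then have "sphere \<phi> \<inter> {u. \<phi> \<in> u} \<noteq> {}" by blast
    moreover have "sphere \<phi> \<inter> {u. \<phi> \<in> u} \<subseteq> {u. \<psi> \<in> u}"
      using c by (simp add: sphere_Int_subset_iff cond_iff_less)
    moreover have "sphere \<phi> \<subseteq> worlds G" using mem by (rule spheres_subset)
    ultimately show ?thesis unfolding sphere_cond_def
      by (intro disjI2 bexI[OF _ mem] conjI) auto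
  qed
qed

end

definition canonical_val :: "fm set \<Rightarrow> nat \<Rightarrow> fm set set" where
  "canonical_val G p = {u \<in> worlds G. Var p \<in> u}"

lemma canonical_sphere_model: "sphere_model (worlds G) (canonical_world.spheres G) (canonical_val G)"
  unfolding sphere_model_def
proof (intro conjI ballI allI)
  fix w assume "w \<in> worlds G"
  then interpret canonical_world G w by (rule canonical_world.intro)
  fix S assume S: "S \<in> spheres"
  then show "S \<noteq> {}" "S \<subseteq> worlds G" by (rule spheres_nonempty, rule spheres_subset)
  show "S \<subseteq> T \<or> T \<subseteq> S" if "T \<in> spheres" for T
    using S that by (rule spheres_chain)
qed (auto simp: canonical_val_def)

lemma truth_lemma:
  "truth_set (worlds G) (canonical_world.spheres G) (canonical_val G) \<phi> = worlds G \<inter> {u. \<phi> \<in> u}"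
proof (induction \<phi>)
  case (Cf \<phi> \<psi>)
  have "sphere_cond (canonical_world.spheres G w) (worlds G \<inter> {u. \<phi> \<in> u}) (worlds G \<inter> {u. \<psi> \<in> u})
      \<longleftrightarrow> \<phi> \<box>\<rightarrow> \<psi> \<in> w" if "w \<in> worlds G" for w
  proof -
    interpret canonical_world G w by standard (rule that)
    show ?thesis by (simp add: sphere_cond_spheres cond_def)
  qed
  then show ?case unfolding truth_set_Cf Cf.IH by blast
next
  case (Impl \<phi> \<psi>)
  show ?case unfolding truth_set.simps Impl.IH by auto
next
  case (Disj \<phi> \<psi>)
  show ?case unfolding truth_set.simps Disj.IH by auto
next
  case (Conj \<phi> \<psi>)
  show ?case unfolding truth_set.simps Conj.IH by auto
qed (auto simp: canonical_val_def)


section \<open>Countable submodels and change of universe\<close>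

instance fm :: countable
  by countable_datatype

text \<open>
  A Loewenheim--Skolem argument: from \<open>w0\<close> on, choose for each world and each pair of formulas one
  sphere deciding the conditional, and in each chosen sphere one witness per formula.
\<close>

lemma countable_submodel:
  assumes model: "sphere_model W \<S> v" and w0: "w0 \<in> W"
  obtains W' \<S>' v' where "sphere_model W' \<S>' v'" "countable W'" "w0 \<in> W'" "W' \<subseteq> W"
    "\<And>\<phi>. truth_set W' \<S>' v' \<phi> = truth_set W \<S> v \<phi> \<inter> W'"
proof -
  let ?t = "truth_set W \<S> v"
  \<comment> \<open>A good sphere meets \<open>\<phi>\<close> in any case and is a witness whenever
    the conditional is true, so one choice settles both outcomes.\<close>
  define good where "good w \<phi> \<psi> S \<longleftrightarrow> S \<in> \<S> w \<and> S \<inter> ?t \<phi> \<noteq> {} \<and>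
    (sphere_cond (\<S> w) (?t \<phi>) (?t \<psi>) \<longrightarrow> S \<inter> ?t \<phi> \<subseteq> ?t \<psi>)" for w \<phi> \<psi> S
  define c where "c w \<phi> \<psi> = (SOME S. good w \<phi> \<psi> S)" for w \<phi> \<psi>
  define d where "d S \<chi> = (SOME u. u \<in> S \<inter> ?t \<chi>)" for S \<chi>
  define N where "N w = {c w \<phi> \<psi> | \<phi> \<psi>. \<Union>(\<S> w) \<inter> ?t \<phi> \<noteq> {}}" for w
  have c: "good w \<phi> \<psi> (c w \<phi> \<psi>)" if "\<Union>(\<S> w) \<inter> ?t \<phi> \<noteq> {}" for w \<phi> \<psi>
  proof -
    have "\<exists>S. good w \<phi> \<psi> S" using that unfolding good_def sphere_cond_def by blast
    then show ?thesis unfolding c_def by (rule someI_ex)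
  qed
  have d: "d S \<chi> \<in> S \<inter> ?t \<chi>" if "S \<inter> ?t \<chi> \<noteq> {}" for S \<chi>
    using that some_in_eq[of "S \<inter> ?t \<chi>"] unfolding d_def by simp
  have N_sub: "N w \<subseteq> \<S> w" for w
    using c unfolding N_def good_def by blast
  define step where "step = (\<lambda>(\<phi>, \<psi>, \<chi>) w. d (c w \<phi> \<psi>) \<chi>)"
  \<comment> \<open>Each list of formula triples codes a finite run of choices, and there are
    countably many lists. Intersecting with \<open>W\<close> discards arbitrary values of
    \<open>SOME\<close> outside the model.\<close>
  define W' where "W' = W \<inter> range (\<lambda>l. foldr step l w0)"
  have "countable W'" by (simp add: W'_def countable_Int2)
  have "w0 \<in> W'" using w0 by (auto simp: W'_def intro: image_eqI[of _ _ "[]"])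
  have W'_sub: "W' \<subseteq> W" by (simp add: W'_def)
  have d_in: "d S \<chi> \<in> W'" if wS: "w \<in> W'" "S \<in> N w" "S \<inter> ?t \<chi> \<noteq> {}" for w S \<chi>
  proof -
    obtain \<phi> \<psi> where S: "S = c w \<phi> \<psi>" using wS by (auto simp: N_def)
    obtain l where l: "w = foldr step l w0" using wS by (auto simp: W'_def)
    have "d S \<chi> = foldr step ((\<phi>, \<psi>, \<chi>) # l) w0" by (simp add: step_def S l)
    moreover have "d S \<chi> \<in> W" using d[OF wS(3)] truth_set_subset[OF model] by blast
    ultimately show ?thesis unfolding W'_def by blast
  qed
  have meets: "S \<inter> W' \<inter> ?t \<chi> \<noteq> {} \<longleftrightarrow> S \<inter> ?t \<chi> \<noteq> {}" if "w \<in> W'" "S \<in> N w" for w S \<chi>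
    using d_in[OF that] d[of S \<chi>] by blast
  have subset: "S \<inter> W' \<inter> ?t \<phi> \<subseteq> ?t \<psi> \<longleftrightarrow> S \<inter> ?t \<phi> \<subseteq> ?t \<psi>" if "w \<in> W'" "S \<in> N w" for w S \<phi> \<psi>
  proof -
    have "w \<in> W" "S \<in> \<S> w" using that N_sub W'_sub by blast+
    then have "S \<subseteq> W" using model by (simp add: sphere_model_def)
    \<comment> \<open>Taking \<open>W'\<close> and \<open>UNIV\<close> for \<open>X\<close> reduces
      both inclusions to the absence of a counterexample, where \<open>meets\<close>
      applies.\<close>
    then have "S \<inter> X \<inter> ?t \<phi> \<subseteq> ?t \<psi> \<longleftrightarrow> \<not> S \<inter> X \<inter> ?t (\<phi> \<^bold>\<and> \<^bold>\<not> \<psi>) \<noteq> {}" for X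
      by auto
    from this[of W'] this[of UNIV] show ?thesis
      unfolding Int_UNIV_right meets[OF that] by blast
  qed
  define \<S>' where "\<S>' w = (\<lambda>S. S \<inter> W') ` N w" for w
  define v' where "v' p = v p \<inter> W'" for p
  have truth: "truth_set W' \<S>' v' \<phi> = ?t \<phi> \<inter> W'" for \<phi>
  proof (induction \<phi>)
    case (Cf \<phi> \<psi>)
    have "sphere_cond (\<S>' w) (?t \<phi> \<inter> W') (?t \<psi> \<inter> W') \<longleftrightarrow> sphere_cond (\<S> w) (?t \<phi>) (?t \<psi>)"
      if w: "w \<in> W'" for w
    proof (cases "\<Union>(\<S> w) \<inter> ?t \<phi> = {}")
      case True
      then show ?thesis using N_sub[of w] unfolding sphere_cond_def \<S>'_def by blast
    next
      case False
      let ?c = "c w \<phi> \<psi>"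
      have cN: "?c \<in> N w" using False unfolding N_def by blast
      have good: "good w \<phi> \<psi> ?c" using False by (rule c)
      have "?c \<inter> W' \<inter> ?t \<phi> \<noteq> {}" using good meets[OF w cN] unfolding good_def by blast
      then have nonvac: "\<Union>(\<S>' w) \<inter> (?t \<phi> \<inter> W') \<noteq> {}" using cN unfolding \<S>'_def by blast
      have "S \<inter> W' \<inter> (A \<inter> W') = S \<inter> W' \<inter> A" "S \<inter> W' \<inter> A \<subseteq> B \<inter> W' \<longleftrightarrow> S \<inter> W' \<inter> A \<subseteq> B" for S A B
        by blast+
      then have "sphere_cond (\<S>' w) (?t \<phi> \<inter> W') (?t \<psi> \<inter> W') \<longleftrightarrow>
          (\<exists>S\<in>N w. S \<inter> W' \<inter> ?t \<phi> \<noteq> {} \<and> S \<inter> W' \<inter> ?t \<phi> \<subseteq> ?t \<psi>)"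
        using nonvac unfolding sphere_cond_def by (simp add: \<S>'_def)
      also have "\<dots> \<longleftrightarrow> (\<exists>S\<in>N w. S \<inter> ?t \<phi> \<noteq> {} \<and> S \<inter> ?t \<phi> \<subseteq> ?t \<psi>)"
        using meets[OF w] subset[OF w] by simp
      also have "\<dots> \<longleftrightarrow> sphere_cond (\<S> w) (?t \<phi>) (?t \<psi>)"
      proof
        show "sphere_cond (\<S> w) (?t \<phi>) (?t \<psi>)"
          if "\<exists>S\<in>N w. S \<inter> ?t \<phi> \<noteq> {} \<and> S \<inter> ?t \<phi> \<subseteq> ?t \<psi>"
          using that N_sub[of w] unfolding sphere_cond_def by (metis subsetD)
        show "\<exists>S\<in>N w. S \<inter> ?t \<phi> \<noteq> {} \<and> S \<inter> ?t \<phi> \<subseteq> ?t \<psi>"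
          if "sphere_cond (\<S> w) (?t \<phi>) (?t \<psi>)"
          using that good unfolding good_def by (intro bexI[OF _ cN]) simp
      qed
      finally show ?thesis .
    qed
    then show ?case using W'_sub unfolding truth_set_Cf Cf.IH by blast
  qed (use W'_sub in \<open>auto simp: v'_def\<close>)
  have "sphere_model W' \<S>' v'"
    unfolding sphere_model_def
  proof (intro conjI ballI allI)
    fix w assume w: "w \<in> W'"
    then have chain: "chain\<^sub>\<subseteq> (\<S> w)" using sphere_model_chain[OF model] W'_sub by blast
    fix S assume S: "S \<in> \<S>' w"
    then obtain S0 where S0: "S0 \<in> N w" "S = S0 \<inter> W'" by (auto simp: \<S>'_def)
    then have "S0 \<in> \<S> w" using N_sub by blast
    moreover have "w \<in> W" using w W'_sub by blast
    ultimately have "S0 \<noteq> {}" "S0 \<subseteq> W" using model by (simp_all add: sphere_model_def)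
    \<comment> \<open>Nonemptiness is turned into an instance of \<open>meets\<close>, as
      \<open>1\<close> is true throughout \<open>W\<close>.\<close>
    then have "S0 \<inter> ?t \<^bold>1 \<noteq> {}" by auto
    then show "S \<noteq> {}" using meets[OF w S0(1)] S0(2) by blast
    show "S \<subseteq> W'" using S0 by blast
    fix T assume "T \<in> \<S>' w"
    then obtain T0 where T0: "T0 \<in> N w" "T = T0 \<inter> W'" by (auto simp: \<S>'_def)
    have "S0 \<subseteq> T0 \<or> T0 \<subseteq> S0"
      using chain S0 T0 N_sub[of w] unfolding chain_subset_def by blast
    then show "S \<subseteq> T \<or> T \<subseteq> S" using S0 T0 by blast
  qed (simp add: v'_def)
  then show thesis
    using \<open>countable W'\<close> \<open>w0 \<in> W'\<close> W'_sub truth by (rule that)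
qed

lemma isomorphic_model:
  assumes model: "sphere_model W \<S> v" and inj: "inj_on f W"
  obtains \<S>' v' where "sphere_model (f ` W) \<S>' v'"
    "\<And>\<phi>. truth_set (f ` W) \<S>' v' \<phi> = f ` truth_set W \<S> v \<phi>"
proof -
  define \<S>' where "\<S>' x = (`) f ` \<S> (inv_into W f x)" for x
  define v' where "v' p = f ` v p" for p
  have \<S>': "\<S>' (f w) = (`) f ` \<S> w" if "w \<in> W" for w
    using inj that by (simp add: \<S>'_def)
  have Int: "f ` A \<inter> f ` B = f ` (A \<inter> B)" if "A \<subseteq> W" "B \<subseteq> W" for A B
    using inj_on_image_Int[OF inj that] by simp
  have sub: "f ` A \<subseteq> f ` B \<longleftrightarrow> A \<subseteq> B" if "A \<subseteq> W" "B \<subseteq> W" for A B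
    using inj that unfolding inj_on_def by blast
  have "sphere_model (f ` W) \<S>' v'"
    unfolding sphere_model_def
  proof (intro conjI ballI allI)
    fix x assume "x \<in> f ` W"
    then obtain w where w: "w \<in> W" "x = f w" by blast
    fix S assume "S \<in> \<S>' x"
    then obtain S0 where S: "S0 \<in> \<S> w" "S = f ` S0" using w by (auto simp: \<S>')
    then have "S0 \<noteq> {}" "S0 \<subseteq> W" using model w by (simp_all add: sphere_model_def)
    then show "S \<noteq> {}" "S \<subseteq> f ` W" using S by auto
    fix T assume "T \<in> \<S>' x"
    then obtain T0 where T: "T0 \<in> \<S> w" "T = f ` T0" using w by (auto simp: \<S>')
    have "S0 \<subseteq> T0 \<or> T0 \<subseteq> S0" using model w S T by (simp add: sphere_model_def)
    then show "S \<subseteq> T \<or> T \<subseteq> S" unfolding S(2) T(2) by (blast intro: image_mono)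
  next
    show "v' p \<subseteq> f ` W" for p
      using model unfolding sphere_model_def v'_def by (simp add: image_mono)
  qed
  moreover have "truth_set (f ` W) \<S>' v' \<phi> = f ` truth_set W \<S> v \<phi>" for \<phi>
  proof (induction \<phi>)
    case (Conj \<phi> \<psi>)
    then show ?case by (simp add: Int truth_set_subset[OF model])
  next
    case (Impl \<phi> \<psi>)
    then show ?case
      by (simp add: image_Un inj_on_image_set_diff[OF inj] truth_set_subset[OF model])
  next
    case (Cf \<phi> \<psi>)
    let ?A = "truth_set W \<S> v \<phi>" and ?B = "truth_set W \<S> v \<psi>"
    have "sphere_cond (\<S>' (f w)) (f ` ?A) (f ` ?B) \<longleftrightarrow> sphere_cond (\<S> w) ?A ?B" if w: "w \<in> W" for w
    proof -
      have S: "S \<subseteq> W" if "S \<in> \<S> w" for S using that w model by (simp add: sphere_model_def)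
      have "f ` S \<inter> f ` ?A = f ` (S \<inter> ?A)" if "S \<in> \<S> w" for S
        using Int[OF S[OF that]] truth_set_subset[OF model] by blast
      moreover have "f ` (S \<inter> ?A) \<subseteq> f ` ?B \<longleftrightarrow> S \<inter> ?A \<subseteq> ?B" for S
        by (rule sub) (use truth_set_subset[OF model] in blast)+
      moreover have "f ` \<Union>(\<S> w) \<inter> f ` ?A = f ` (\<Union>(\<S> w) \<inter> ?A)"
        using Int S truth_set_subset[OF model] by (metis Union_least)
      ultimately show ?thesis
        unfolding sphere_cond_def \<S>'[OF w] by (simp flip: image_Union)
    qed
    then show ?case unfolding truth_set_Cf Cf.IH by blast
  qed (simp_all add: v'_def image_Un)
  ultimately show thesis by (rule that)
qed


section \<open>Completeness\<close>

text \<open>The local equivalence at \<open>w\<close> refutes whatever \<open>u\<close> lacks. The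
  last clause survives the passage to a submodel because all remaining worlds are in
  \<open>worlds G\<close>; it keeps global premises true everywhere.\<close>

lemma canonical_countable_model:
  assumes inf: "infinite (UNIV :: 'w set)" and u: "u \<in> worlds G"
  obtains W :: "'w set" and \<S> v w where "sphere_model W \<S> v" "w \<in> W"
    "\<And>\<phi>. w \<in> truth_set W \<S> v \<phi> \<longleftrightarrow> \<phi> \<in> u"
    "\<And>\<phi>. GV_deriv G \<phi> \<Longrightarrow> W \<subseteq> truth_set W \<S> v \<phi>"
proof -
  obtain W' \<S>' v' where W': "sphere_model W' \<S>' v'" "countable W'" "u \<in> W'" "W' \<subseteq> worlds G"
    and truth': "\<And>\<phi>. truth_set W' \<S>' v' \<phi> =
      truth_set (worlds G) (canonical_world.spheres G) (canonical_val G) \<phi> \<inter> W'"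
    using countable_submodel[OF canonical_sphere_model u] by metis
  obtain g :: "nat \<Rightarrow> 'w" where g: "inj g" using infinite_countable_subset[OF inf] by blast
  let ?f = "g \<circ> to_nat_on W'"
  have inj: "inj_on ?f W'"
    using W'(2) g by (intro comp_inj_on inj_on_to_nat_on) (auto intro: inj_on_subset)
  obtain \<S> v where model: "sphere_model (?f ` W') \<S> v"
    and truth: "\<And>\<phi>. truth_set (?f ` W') \<S> v \<phi> = ?f ` truth_set W' \<S>' v' \<phi>"
    using isomorphic_model[OF W'(1) inj] by metis
  have mem: "?f x \<in> truth_set (?f ` W') \<S> v \<phi> \<longleftrightarrow> \<phi> \<in> x" if x: "x \<in> W'" for x \<phi>
  proof -
    have "?f x \<in> ?f ` truth_set W' \<S>' v' \<phi> \<longleftrightarrow> x \<in> truth_set W' \<S>' v' \<phi>"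
      using inj x truth_set_subset[OF W'(1)] by (rule inj_on_image_mem_iff)
    then show ?thesis unfolding truth unfolding truth' truth_lemma using x W'(4) by blast
  qed
  show thesis
  proof (rule that[OF model])
    show "?f u \<in> ?f ` W'" using W'(3) by (rule imageI)
    show "?f u \<in> truth_set (?f ` W') \<S> v \<phi> \<longleftrightarrow> \<phi> \<in> u" for \<phi> using W'(3) by (rule mem)
    show "?f ` W' \<subseteq> truth_set (?f ` W') \<S> v \<phi>" if "GV_deriv G \<phi>" for \<phi>
      using that W'(4) mem worlds_thm by blast
  qed
qed

theorem theorem5p36:
  fixes \<Gamma> :: "fm set" and \<phi> :: fm
  assumes "infinite (UNIV :: 'w set)"
  shows "(\<Gamma> \<turnstile>GV \<phi> \<longleftrightarrow> models_g TYPE('w) \<Gamma> \<phi>) \<and>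
         (\<Gamma> \<turnstile>LV \<phi> \<longleftrightarrow> models_l TYPE('w) \<Gamma> \<phi>)"
proof (intro conjI iffI)
  assume "\<Gamma> \<turnstile>GV \<phi>"
  then show "models_g TYPE('w) \<Gamma> \<phi>"
    using GV_deriv_sound unfolding GV_iff_deriv models_g_def by blast
next
  assume valid: "models_g TYPE('w) \<Gamma> \<phi>"
  have "GV_deriv \<Gamma> \<phi>"
    unfolding GV_deriv_iff_worlds
  proof
    fix u assume u: "u \<in> worlds \<Gamma>"
    obtain W :: "'w set" and \<S> v w where m: "sphere_model W \<S> v" "w \<in> W"
      "\<And>\<phi>. w \<in> truth_set W \<S> v \<phi> \<longleftrightarrow> \<phi> \<in> u"
      "\<And>\<phi>. GV_deriv \<Gamma> \<phi> \<Longrightarrow> W \<subseteq> truth_set W \<S> v \<phi>"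
      using canonical_countable_model[OF assms u] by blast
    then have "\<forall>\<gamma>\<in>\<Gamma>. \<forall>x\<in>W. x \<in> truth_set W \<S> v \<gamma>" using GV_deriv.hyp by blast
    then have "w \<in> truth_set W \<S> v \<phi>" using valid m(1,2) unfolding models_g_def by blast
    then show "\<phi> \<in> u" using m(3) by blast
  qed
  then show "\<Gamma> \<turnstile>GV \<phi>" by (simp add: GV_iff_deriv)
next
  assume "\<Gamma> \<turnstile>LV \<phi>"
  then show "models_l TYPE('w) \<Gamma> \<phi>"
    unfolding LV_iff_deriv models_l_def by (simp add: LV_deriv_sound)
next
  assume valid: "models_l TYPE('w) \<Gamma> \<phi>"
  have "LV_deriv \<Gamma> \<phi>"
  proof (rule ccontr)
    assume "\<not> LV_deriv \<Gamma> \<phi>"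
    then obtain u where u: "maximal_consistent u" "\<Gamma> \<subseteq> u" "\<phi> \<notin> u" by (rule Lindenbaum)
    \<comment> \<open>Without global premises every maximal consistent set is a world, so the
      premises \<open>\<Gamma>\<close> are only required to hold at \<open>u\<close>.\<close>
    then have "u \<in> worlds {}" by (auto simp: worlds_def maximal_consistent_thm)
    then obtain W :: "'w set" and \<S> v w where m: "sphere_model W \<S> v" "w \<in> W"
      "\<And>\<phi>. w \<in> truth_set W \<S> v \<phi> \<longleftrightarrow> \<phi> \<in> u"
      using canonical_countable_model[OF assms] by metis
    then have "w \<in> truth_set W \<S> v \<phi>"
      using valid u(2) unfolding models_l_def by blast
    then show False using m(3) u(3) by blast
  qed
  then show "\<Gamma> \<turnstile>LV \<phi>" by (simp add: LV_iff_deriv)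
qed

end
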